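(* Let $\vec S$ be a submodular separation system without degenerate elements in a distributive universe $\vec U$ of separations, and let $Q\subseteq\vec U$ be down-closed. Then exactly one of the following assertions holds: (i) $S$ has an abstract tangle extending $Q$. (ii) There exists an $S$-tree over $\mathcal T^*\cup\mathcal F_Q$.
   Context: A separation system $(\vec S,\le,{}^* )$ is a partially ordered set with an order-reversing involution $^*:\vec S\to\vec S$. Its elements are called oriented separations. An (unoriented) separation is a set $s=\{\vec s,\vec s^{\,*}\}$; $S$ denotes the set of all these. $\vec s$ is degenerate if $\vec s=\vec s^{\,*}$. A universe of separations is a separation system $\vec U$ whose partial order is a lattice (join $\vee$, meet $\wedge$); it is distributive if this lattice is distributive. A separation system $\vec S$ in $\vec U$ is a subset of $\vec U$ closed under $^*$, with the induced order and involution. It is submodular if for all $\vec s,\vec t\in\vec S$ at least one of $\vec s\vee\vec t$, $\vec s\wedge\vec t$ (computed in $\vec U$) lies in $\vec S$. $\vec x\in\vec U$ is co-small if $\vec x^{\,*}\le\vec x$. $Q\subseteq\vec U$ is down-closed if $\vec r\le\vec s\in Q$ implies $\vec r\in Q$ for all $\vec r,\vec s\in\vec U$. An orientation of $S$ is a set $O\subseteq\vec S$ containing exactly one of $\vec s,\vec s^{\,*}$ for every $s\in S$. It is consistent if whenever $r,s\in S$ are distinct with orientations $\vec r\le\vec s\in O$, then $\vec r^{\,*}\notin O$. Let $\mathcal T$ be the set of all sets $\{\vec r,\vec s,\vec t\}\subseteq\vec U$ ($\vec r,\vec s,\vec t$ not necessarily distinct) such that $\vec r\vee\vec s\vee\vec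 t$ is co-small. An abstract tangle of $S$ is a consistent orientation $O$ of $S$ such that no subset of $O$ is an element of $\mathcal T$. It extends $Q$ if $Q\cap\vec S\subseteq O$. A star is a set $\sigma$ of non-degenerate oriented separations such that $\vec s\le\vec t^{\,*}$ for any two distinct $\vec s,\vec t\in\sigma$; $\mathcal T^*$ is the set of all elements of $\mathcal T$ that are stars. Further, $\mathcal F_Q:=\{\{\vec s^{\,*}\}:\vec s\in Q\text{ non-degenerate}\}$. An $S$-tree is a pair $(T,\alpha)$ of a tree $T$ and a map $\alpha$ from the set $\vec E(T)=\{(x,y): xy\in E(T)\}$ of orientations of edges of $T$ to $\vec S$ such that $\alpha(y,x)=\alpha(x,y)^*$ for all $xy\in E(T)$. For $\mathcal F\subseteq 2^{\vec U}$ it is an $S$-tree over $\mathcal F$ if $\alpha(F_t)\in\mathcal F$ for every node $t$ of $T$, where $F_t=\{(s,t): st\in E(T)\}$. *)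

theory Defs
  imports "Graph_Theory.Digraph_Component"
begin

text \<open>
  The ambient separation system (universe) is a type, the separation systems in it are sets of
  elements of that type. The postfix star is the involution.
\<close>

class separation_system = order +
  fixes invol :: "'a \<Rightarrow> 'a"  (\<open>_\<^sup>\<star>\<close> [1000] 999)
  assumes invol_invol: "(s\<^sup>\<star>)\<^sup>\<star> = s"
    and invol_antimono: "s \<le> t \<Longrightarrow> t\<^sup>\<star> \<le> s\<^sup>\<star>"

class separation_universe = separation_system + lattice

class distributive_universe = separation_universe + distrib_lattice

definition separation_system_in :: "'a::separation_universe set \<Rightarrow> bool" where
  "separation_system_in S \<longleftrightarrow> (\<forall>s\<in>S. s\<^sup>\<star> \<in> S)"

definition unoriented :: "'a::separation_system \<Rightarrow> 'a set" where
  "unoriented s = {s, s\<^sup>\<star>}"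

definition degenerate :: "'a::separation_system \<Rightarrow> bool" where
  "degenerate s \<longleftrightarrow> s = s\<^sup>\<star>"

definition submodular :: "'a::separation_universe set \<Rightarrow> bool" where
  "submodular S \<longleftrightarrow> (\<forall>s\<in>S. \<forall>t\<in>S. sup s t \<in> S \<or> inf s t \<in> S)"

definition co_small :: "'a::separation_system \<Rightarrow> bool" where
  "co_small x \<longleftrightarrow> x\<^sup>\<star> \<le> x"

definition down_closed :: "'a::order set \<Rightarrow> bool" where
  "down_closed Q \<longleftrightarrow> (\<forall>r s. r \<le> s \<longrightarrow> s \<in> Q \<longrightarrow> r \<in> Q)"

definition orientation_of :: "'a::separation_system set \<Rightarrow> 'a set \<Rightarrow> bool" where
  "orientation_of S O' \<longleftrightarrow>
     O' \<subseteq> S \<and> (\<forall>u \<in> unoriented ` S. \<exists>!s. s \<in> u \<and> s \<in> O')"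

definition consistent :: "'a::separation_system set \<Rightarrow> 'a set \<Rightarrow> bool" where
  "consistent S O' \<longleftrightarrow>
     (\<forall>r\<in>S. \<forall>s\<in>S. unoriented r \<noteq> unoriented s \<longrightarrow> r \<le> s \<longrightarrow> s \<in> O' \<longrightarrow> r\<^sup>\<star> \<notin> O')"

definition cosmall_triples :: "'a::separation_universe set set" where
  "cosmall_triples = {{r, s, t} | r s t. co_small (sup (sup r s) t)}"

definition abstract_tangle :: "'a::separation_universe set \<Rightarrow> 'a set \<Rightarrow> bool" where
  "abstract_tangle S O' \<longleftrightarrow>
     orientation_of S O' \<and> consistent S O' \<and> (\<forall>\<sigma>. \<sigma> \<subseteq> O' \<longrightarrow> \<sigma> \<notin> cosmall_triples)"

definition extends :: "'a set \<Rightarrow> 'a set \<Rightarrow> 'a set \<Rightarrow> bool" where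
  "extends S O' Q \<longleftrightarrow> Q \<inter> S \<subseteq> O'"

definition star :: "'a::separation_system set \<Rightarrow> bool" where
  "star \<sigma> \<longleftrightarrow> (\<forall>s\<in>\<sigma>. \<not> degenerate s) \<and> (\<forall>s\<in>\<sigma>. \<forall>t\<in>\<sigma>. s \<noteq> t \<longrightarrow> s \<le> t\<^sup>\<star>)"

definition cosmall_triple_stars :: "'a::separation_universe set set" where
  "cosmall_triple_stars = {\<sigma> \<in> cosmall_triples. star \<sigma>}"

definition forced_singletons :: "'a::separation_system set \<Rightarrow> 'a set set" where
  "forced_singletons Q = {{s\<^sup>\<star>} | s. s \<in> Q \<and> \<not> degenerate s}"

text \<open>
  An undirected simple graph is a symmetric loop-free digraph (\<open>pair_graph\<close>, which includes
  finiteness), so its arcs are exactly the orientations of its edges. In such a digraph every edge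
  yields a directed cycle of length 2; hence the library's \<open>forest\<close> and \<open>tree\<close> do not describe
  undirected trees, and only cycles of length at least 3 are forbidden here. Connectedness
  includes that there is at least one vertex. Without finiteness, a two-way infinite path with
  \<open>\<alpha>\<close> constant along one direction would always be an S-tree over the stars above.
\<close>

definition undirected_tree :: "'v pair_pre_digraph \<Rightarrow> bool" where
  "undirected_tree T \<longleftrightarrow>
     pair_graph T \<and> connected (with_proj T) \<and>
     \<not> (\<exists>p. pre_digraph.cycle (with_proj T) p \<and> length p \<ge> 3)"

definition S_tree ::
  "'a::separation_system set \<Rightarrow> 'v pair_pre_digraph \<Rightarrow> ('v \<times> 'v \<Rightarrow> 'a) \<Rightarrow> bool" where
  "S_tree S T \<alpha> \<longleftrightarrow>
     undirected_tree T \<and>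
     (\<forall>e \<in> parcs T. \<alpha> e \<in> S) \<and>
     (\<forall>(x, y) \<in> parcs T. \<alpha> (y, x) = (\<alpha> (x, y))\<^sup>\<star>)"

definition S_tree_over ::
  "'a::separation_system set \<Rightarrow> 'a set set \<Rightarrow> 'v pair_pre_digraph \<Rightarrow> ('v \<times> 'v \<Rightarrow> 'a) \<Rightarrow> bool" where
  "S_tree_over S F T \<alpha> \<longleftrightarrow>
     S_tree S T \<alpha> \<and> (\<forall>t \<in> pverts T. \<alpha> ` in_arcs (with_proj T) t \<in> F)"

text \<open>Finite trees can have their vertices named by natural numbers without loss of generality.\<close>

definition has_S_tree_over :: "'a::separation_system set \<Rightarrow> 'a set set \<Rightarrow> bool" where
  "has_S_tree_over S F \<longleftrightarrow>
     (\<exists>(T :: nat pair_pre_digraph) (\<alpha> :: nat \<times> nat \<Rightarrow> 'a). S_tree_over S F T \<alpha>)"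

end

theory Submission
  imports Defs
begin

text \<open>
  Close \<open>Q\<close> under the deductions given by small separations and by stars of co-small triples. If
  some \<open>s\<close> and its inverse are both deduced, gluing the two derivations along an edge gives an
  S-tree. Otherwise let first \<open>S\<close> be finite and take a maximal down-closed \<open>X \<supseteq> Q \<inter> S\<close> without such
  a contradiction. Every minimal \<open>r \<in> S - X\<close> has its inverse deduced from \<open>X\<close>, by maximality. So if
  \<open>X\<close> contained neither \<open>s\<close> nor its inverse, minimal elements below the two would give two deduced
  separations pointing away from each other, and submodularity lets us shift their derivations to
  a common separation, a contradiction. Hence \<open>X\<close> is an orientation; it is consistent since it is
  down-closed, and uncrossing a co-small triple in \<open>X\<close> yields a star, so \<open>X\<close> is a tangle.

  Infinite \<open>S\<close> follow by compactness, as finitely many elements of a distributive universe generate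
  a finite one. Conversely, a tangle orients the edges of an S-tree, and a sink of this
  orientation is a node whose star the tangle cannot contain.
\<close>

section \<open>The involution and the lattice operations\<close>

lemma invol_le_iff [simp]: "s\<^sup>\<star> \<le> t\<^sup>\<star> \<longleftrightarrow> t \<le> s" for s t :: "'a::separation_system"
  by (metis invol_antimono invol_invol)

declare invol_invol [simp]

lemma invol_eq_iff [simp]: "s\<^sup>\<star> = t\<^sup>\<star> \<longleftrightarrow> s = t" for s t :: "'a::separation_system"
  by (metis invol_invol)

lemma invol_le_swap: "s\<^sup>\<star> \<le> t \<longleftrightarrow> t\<^sup>\<star> \<le> s" for s t :: "'a::separation_system"
  using invol_le_iff[of s "t\<^sup>\<star>"] by simp

lemma le_invol_swap: "s \<le> t\<^sup>\<star> \<longleftrightarrow> t \<le> s\<^sup>\<star>" for s t :: "'a::separation_system"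
  using invol_le_iff[of "s\<^sup>\<star>" t] by simp

lemma invol_sup: "(sup s t)\<^sup>\<star> = inf (s\<^sup>\<star>) (t\<^sup>\<star>)" for s t :: "'a::separation_universe"
proof (rule antisym)
  show "(sup s t)\<^sup>\<star> \<le> inf (s\<^sup>\<star>) (t\<^sup>\<star>)" by simp
  have "sup s t \<le> (inf (s\<^sup>\<star>) (t\<^sup>\<star>))\<^sup>\<star>"
    by (simp add: le_invol_swap[of s] le_invol_swap[of t])
  then show "inf (s\<^sup>\<star>) (t\<^sup>\<star>) \<le> (sup s t)\<^sup>\<star>" by (simp add: le_invol_swap)
qed

lemma invol_inf: "(inf s t)\<^sup>\<star> = sup (s\<^sup>\<star>) (t\<^sup>\<star>)" for s t :: "'a::separation_universe"
  by (metis invol_sup invol_invol)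

text \<open>The second corner is the meet of \<open>s\<close> and the inverse of \<open>r\<close>,
  and the first is the inverse of their join.\<close>

lemma submodular_cases:
  assumes "separation_system_in S" "submodular S" "r \<in> S" "s \<in> S"
  shows "inf r (s\<^sup>\<star>) \<in> S \<or> inf s (r\<^sup>\<star>) \<in> S"
proof -
  have "sup s (r\<^sup>\<star>) \<in> S \<or> inf s (r\<^sup>\<star>) \<in> S"
    using assms by (auto simp: submodular_def separation_system_in_def)
  moreover have "(sup s (r\<^sup>\<star>))\<^sup>\<star> = inf r (s\<^sup>\<star>)" by (simp add: invol_sup inf_commute)
  ultimately show ?thesis using assms(1) by (metis separation_system_in_def)
qed

text \<open>By distributivity, the inverse of the new join is the join of \<open>?m\<close> and a
  separation below \<open>s\<close>. By hypothesis \<open>?m\<close> lies below the old join; it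
  also lies below the inverse of \<open>s\<close>, and the part of the old join below that inverse
  survives the replacement of \<open>r\<close>.\<close>

lemma co_small_uncross:
  fixes r s t :: "'u::distributive_universe"
  assumes "co_small (sup (sup r s) t)"
  shows "co_small (sup (sup (inf r (s\<^sup>\<star>)) s) t)"
proof -
  let ?w = "sup (sup (inf r (s\<^sup>\<star>)) s) t"
  let ?m = "inf (inf (r\<^sup>\<star>) (s\<^sup>\<star>)) (t\<^sup>\<star>)"
  have "?m \<le> sup (sup r s) t" using assms by (simp add: co_small_def invol_sup)
  then have "?m \<le> inf (sup (sup r s) t) (s\<^sup>\<star>)" by (simp add: le_infI1)
  also have "\<dots> \<le> ?w"
    by (simp add: inf_sup_distrib2 le_supI1 le_supI2 le_infI1)
  finally have "?m \<le> ?w" .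
  moreover have "inf (inf s (s\<^sup>\<star>)) (t\<^sup>\<star>) \<le> ?w" by (simp add: le_supI1 le_infI1)
  ultimately have "sup ?m (inf (inf s (s\<^sup>\<star>)) (t\<^sup>\<star>)) \<le> ?w" by simp
  then show ?thesis
    by (simp add: co_small_def invol_sup invol_inf inf_sup_distrib2 inf_sup_distrib1)
qed

text \<open>This keeps a \<open>triple\<close> step intact when its labels are met with
  \<open>a\<close>. Distributivity splits the inverse of the new join into a part below the inverse
  of \<open>a\<close>, which is one of the joined terms, and \<open>inf ?m a\<close>, which is
  bounded by meeting the hypothesis with \<open>a\<close>.\<close>

lemma co_small_shift:
  fixes x y z a :: "'u::distributive_universe"
  assumes "co_small (sup (sup x y) (z\<^sup>\<star>))"
  shows "co_small (sup (sup (inf x a) (inf y a)) ((inf z a)\<^sup>\<star>))"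
proof -
  let ?w = "sup (sup (inf x a) (inf y a)) (sup (z\<^sup>\<star>) (a\<^sup>\<star>))"
  let ?m = "inf (inf (x\<^sup>\<star>) (y\<^sup>\<star>)) z"
  have "?m \<le> sup (sup x y) (z\<^sup>\<star>)" using assms by (simp add: co_small_def invol_sup)
  then have "inf ?m a \<le> inf (sup (sup x y) (z\<^sup>\<star>)) a" by (simp add: le_infI1)
  also have "\<dots> \<le> ?w"
    by (simp add: inf_sup_distrib2 le_supI1 le_supI2 le_infI1)
  finally have 1: "inf ?m a \<le> ?w" .
  have 2: "inf (a\<^sup>\<star>) (inf z a) \<le> ?w" by (simp add: le_supI2 le_infI1)
  have "inf (inf (sup (x\<^sup>\<star>) (a\<^sup>\<star>)) (sup (y\<^sup>\<star>) (a\<^sup>\<star>))) (inf z a)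
      = inf (sup (inf (x\<^sup>\<star>) (y\<^sup>\<star>)) (a\<^sup>\<star>)) (inf z a)"
    by (simp only: sup_inf_distrib2)
  also have "\<dots> = sup (inf ?m a) (inf (a\<^sup>\<star>) (inf z a))"
    by (simp only: inf_sup_distrib2 inf_assoc)
  finally have "inf (inf (sup (x\<^sup>\<star>) (a\<^sup>\<star>)) (sup (y\<^sup>\<star>) (a\<^sup>\<star>))) (inf z a)
      = sup (inf ?m a) (inf (a\<^sup>\<star>) (inf z a))" .
  with 1 2 show ?thesis
    by (simp add: co_small_def invol_sup invol_inf)
qed

section \<open>Forced separations\<close>

text \<open>
  A derivation of \<open>s \<in> forced S Q\<close> is an S-tree with one dangling edge, labelled \<open>s\<close> towards the
  outside: leaves are elements of \<open>Q\<close> or small separations, and the other nodes are triple stars.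
\<close>

inductive_set forced :: "'a::separation_universe set \<Rightarrow> 'a set \<Rightarrow> 'a set" for S Q where
  given: "s \<in> S \<Longrightarrow> s \<in> Q \<Longrightarrow> s \<in> forced S Q"
| small: "s \<in> S \<Longrightarrow> s \<le> s\<^sup>\<star> \<Longrightarrow> s \<in> forced S Q"
| triple: "x \<in> forced S Q \<Longrightarrow> y \<in> forced S Q \<Longrightarrow> z \<in> S \<Longrightarrow> x \<le> z \<Longrightarrow> y \<le> z \<Longrightarrow>
    x = y \<or> x \<le> y\<^sup>\<star> \<Longrightarrow> co_small (sup (sup x y) (z\<^sup>\<star>)) \<Longrightarrow> z \<in> forced S Q"

definition contradictory :: "'a::separation_universe set \<Rightarrow> 'a set \<Rightarrow> bool" where
  "contradictory S Q \<longleftrightarrow> (\<exists>s. s \<in> forced S Q \<and> s\<^sup>\<star> \<in> forced S Q)"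

lemma forced_in: "s \<in> forced S Q \<Longrightarrow> s \<in> S"
  by (induction rule: forced.induct) auto

lemma forced_mono:
  assumes "S \<subseteq> S'" "S \<inter> Q \<subseteq> Q'"
  shows "forced S Q \<subseteq> forced S' Q'"
proof
  fix s assume "s \<in> forced S Q"
  then show "s \<in> forced S' Q'"
  proof induction
    case (triple x y z)
    then show ?case using assms by (meson forced.triple subsetD)
  qed (use assms in \<open>auto intro: forced.given forced.small\<close>)
qed

text \<open>Every label of the derivation is met with \<open>a\<close>. All labels lie below the
  root label, hence below \<open>s\<close>, so by \<open>closed\<close> their meets with
  \<open>a\<close> stay in \<open>S\<close>. Leaves remain in \<open>Q\<close> or small, and inner
  nodes remain valid by \<open>co_small_shift\<close>.\<close>

lemma forced_shift:
  fixes S Q :: "'u::distributive_universe set"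
  assumes "x \<in> forced S Q" "x \<le> s"
    and closed: "\<And>x. x \<in> S \<Longrightarrow> x \<le> s \<Longrightarrow> inf x a \<in> S"
    and down: "\<And>p q. p \<in> S \<Longrightarrow> q \<in> S \<Longrightarrow> p \<le> q \<Longrightarrow> q \<in> Q \<Longrightarrow> p \<in> Q"
  shows "inf x a \<in> forced S Q"
  using assms(1,2)
proof induction
  case (given x)
  then show ?case using closed down[of "inf x a" x] by (auto intro: forced.given)
next
  case (small x)
  have "inf x a \<le> (inf x a)\<^sup>\<star>"
    using small by (simp add: invol_inf le_supI1 le_infI1)
  then show ?case using small closed by (auto intro: forced.small)
next
  case (triple x y z)
  show ?case
  proof (rule forced.triple[of "inf x a" _ _ "inf y a"])
    show "inf x a = inf y a \<or> inf x a \<le> (inf y a)\<^sup>\<star>"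
      using triple.hyps by (metis invol_inf le_infI1 le_supI1)
    show "co_small (sup (sup (inf x a) (inf y a)) ((inf z a)\<^sup>\<star>))"
      using triple by (intro co_small_shift)
  qed (use triple closed in \<open>auto intro: le_infI1\<close>)
qed

text \<open>
  Choose \<open>a\<close> minimal subject to the first closure property; if the second one failed, a maximal
  witness \<open>y\<close> of the failure would make \<open>inf y a\<close> a smaller choice.
\<close>

lemma separating_element:
  fixes S :: "'u::distributive_universe set"
  assumes "finite S" "submodular S" "r \<in> S" "s \<in> S" "r \<le> s"
  obtains a where "a \<in> S" "r \<le> a" "a \<le> s"
    "\<And>x. x \<in> S \<Longrightarrow> x \<le> s \<Longrightarrow> inf x a \<in> S" "\<And>y. y \<in> S \<Longrightarrow> r \<le> y \<Longrightarrow> sup y a \<in> S"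
proof -
  let ?A = "{a \<in> S. r \<le> a \<and> a \<le> s \<and> (\<forall>x\<in>S. x \<le> s \<longrightarrow> inf x a \<in> S)}"
  have "s \<in> ?A" using assms by (auto simp: inf_absorb1)
  then obtain a where a: "a \<in> ?A" and min: "\<And>b. b \<in> ?A \<Longrightarrow> b \<le> a \<Longrightarrow> a = b"
    using finite_has_minimal[of ?A] assms(1) by auto
  have "sup y a \<in> S" if "y \<in> S" "r \<le> y" for y
  proof (rule ccontr)
    assume "sup y a \<notin> S"
    let ?Y = "{y \<in> S. r \<le> y \<and> sup y a \<notin> S}"
    have "y \<in> ?Y" using that \<open>sup y a \<notin> S\<close> by simp
    then obtain y where y: "y \<in> ?Y" and max: "\<And>b. b \<in> ?Y \<Longrightarrow> y \<le> b \<Longrightarrow> y = b"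
      using finite_has_maximal[of ?Y] assms(1) by auto
    have ya: "inf y a \<in> S" using y a assms(2) by (auto simp: submodular_def)
    have "inf x (inf y a) \<in> S" if x: "x \<in> S" "x \<le> s" for x
    proof -
      let ?x = "inf x a"
      have xS: "?x \<in> S" using a x by auto
      have "inf y ?x \<in> S"
      proof (rule ccontr)
        assume n: "inf y ?x \<notin> S"
        then have S: "sup y ?x \<in> S" using y xS assms(2) by (auto simp: submodular_def)
        \<comment> \<open>As \<open>?x\<close> lies below \<open>a\<close>, replacing
          \<open>y\<close> by \<open>sup y ?x\<close> does not change the join with
          \<open>a\<close>. So \<open>sup y ?x\<close> is another failure, and maximality of
          \<open>y\<close> gives \<open>?x \<le> y\<close>.\<close>
        have "sup (sup y ?x) a = sup y a" by (simp add: sup_assoc sup_absorb2)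
        with S y have "sup y ?x \<in> ?Y" by (auto intro: le_supI1)
        from max[OF this] have "?x \<le> y" by (metis sup_ge1 sup_ge2)
        with n xS show False by (simp add: inf_absorb2)
      qed
      then show ?thesis by (simp add: inf_left_commute)
    qed
    then have "inf y a \<in> ?A" using ya y a by (auto intro: le_infI2)
    from min[OF this] have "a \<le> y" by (metis inf_le1 inf_le2)
    then show False using y by (auto simp: sup_absorb1)
  qed
  with a that show ?thesis by auto
qed

text \<open>Both derivations are shifted to a common separating element.\<close>

lemma contradictory_if_pointing_apart:
  fixes S Q :: "'u::distributive_universe set"
  assumes "finite S" "separation_system_in S" "submodular S"
    and down: "\<And>p q. p \<in> S \<Longrightarrow> q \<in> S \<Longrightarrow> p \<le> q \<Longrightarrow> q \<in> Q \<Longrightarrow> p \<in> Q"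
    and "r \<le> s" "s \<in> forced S Q" "r\<^sup>\<star> \<in> forced S Q"
  shows "contradictory S Q"
proof -
  have inv: "x\<^sup>\<star> \<in> S" if "x \<in> S" for x using that assms(2) by (auto simp: separation_system_in_def)
  have rs: "r \<in> S" "s \<in> S" using inv[of "r\<^sup>\<star>"] assms(6,7)[THEN forced_in] by auto
  obtain a where a: "a \<in> S" "r \<le> a" "a \<le> s"
    "\<And>x. x \<in> S \<Longrightarrow> x \<le> s \<Longrightarrow> inf x a \<in> S" "\<And>y. y \<in> S \<Longrightarrow> r \<le> y \<Longrightarrow> sup y a \<in> S"
    using separating_element[OF assms(1,3) rs \<open>r \<le> s\<close>] by metis
  \<comment> \<open>Since \<open>r \<le> a \<le> s\<close>, the two shifted root labels are
    \<open>a\<close> and its inverse.\<close>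
  have "inf s a \<in> forced S Q"
    by (rule forced_shift[where s = s]) (use assms a in auto)
  moreover have "inf (r\<^sup>\<star>) (a\<^sup>\<star>) \<in> forced S Q"
  proof (rule forced_shift[where s = "r\<^sup>\<star>"])
    fix x assume "x \<in> S" "x \<le> r\<^sup>\<star>"
    then have "sup (x\<^sup>\<star>) a \<in> S" using a inv by (simp add: le_invol_swap)
    from inv[OF this] show "inf x (a\<^sup>\<star>) \<in> S" by (simp add: invol_sup)
  qed (use assms in auto)
  ultimately show ?thesis
    using a by (auto simp: contradictory_def inf_absorb2 intro!: exI[of _ a])
qed

text \<open>
  Labels increase towards the root of a derivation, so two leaves labelled \<open>s\<close> would make \<open>s\<close>
  small; a derivation using \<open>s\<close> once can be re-rooted at that leaf.
\<close>

lemma forced_insert: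
  fixes S Q :: "'u::distributive_universe set"
  assumes "separation_system_in S" "s \<notin> forced S Q" "t \<in> forced S (insert s Q)"
  shows "t \<in> forced S Q \<or> s \<le> t \<and> (t\<^sup>\<star> \<in> forced S Q \<longrightarrow> s\<^sup>\<star> \<in> forced S Q)"
  using assms(3)
proof induction
  case (given t)
  then show ?case by (auto intro: forced.given)
next
  case (small t)
  then show ?case by (auto intro: forced.small)
next
  case (triple x y z)
  have S: "x \<in> S" "y \<in> S" "x\<^sup>\<star> \<in> S" "y\<^sup>\<star> \<in> S"
    using triple.hyps(1,2)[THEN forced_in] assms(1) by (auto simp: separation_system_in_def)
  have cs: "co_small (sup (sup y (z\<^sup>\<star>)) x)" "co_small (sup (sup x (z\<^sup>\<star>)) y)"
    using triple.hyps(7) by (simp_all add: ac_simps)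
  consider "x \<in> forced S Q" "y \<in> forced S Q"
    | "x \<notin> forced S Q" "y \<in> forced S Q" | "x \<in> forced S Q" "y \<notin> forced S Q"
    | "x \<notin> forced S Q" "y \<notin> forced S Q" by blast
  then show ?case
  proof cases
    case 1
    then show ?thesis using forced.triple triple.hyps by blast
  next
    case 2
    then have *: "s \<le> x" "x\<^sup>\<star> \<in> forced S Q \<longrightarrow> s\<^sup>\<star> \<in> forced S Q" "x \<le> y\<^sup>\<star>" using triple by auto
    \<comment> \<open>The node is turned around: the same co-small join, read with \<open>y\<close>
      and the inverse of \<open>z\<close> as premises, deduces the inverse of \<open>x\<close>. The
      induction hypothesis leads on from there to the leaf \<open>s\<close>.\<close>
    have "x\<^sup>\<star> \<in> forced S Q" if "z\<^sup>\<star> \<in> forced S Q"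
      by (rule forced.triple[of y _ _ "z\<^sup>\<star>"])
        (use that triple * 2 S cs in \<open>auto simp: le_invol_swap ac_simps\<close>)
    then show ?thesis using * triple by auto
  next
    case 3
    then have *: "s \<le> y" "y\<^sup>\<star> \<in> forced S Q \<longrightarrow> s\<^sup>\<star> \<in> forced S Q" "x \<le> y\<^sup>\<star>" using triple by auto
    have "y\<^sup>\<star> \<in> forced S Q" if "z\<^sup>\<star> \<in> forced S Q"
      by (rule forced.triple[of x _ _ "z\<^sup>\<star>"])
        (use that triple * 3 S cs in \<open>auto simp: le_invol_swap ac_simps\<close>)
    then show ?thesis using * triple by auto
  next
    case 4
    then have *: "s \<le> x" "s \<le> y" "x\<^sup>\<star> \<in> forced S Q \<longrightarrow> s\<^sup>\<star> \<in> forced S Q" using triple by auto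
    show ?thesis
    proof (cases "x = y")
      case True
      \<comment> \<open>With equal premises the node has only two distinct labels, so the turned
        node takes the inverse of \<open>z\<close> twice.\<close>
      have "x\<^sup>\<star> \<in> forced S Q" if "z\<^sup>\<star> \<in> forced S Q"
        by (rule forced.triple[of "z\<^sup>\<star>" _ _ "z\<^sup>\<star>"])
          (use that triple True S in \<open>auto simp: sup_commute\<close>)
      then show ?thesis using * triple by auto
    next
      case False
      \<comment> \<open>Both branches use \<open>s\<close>, and \<open>x\<close> and
        \<open>y\<close> point towards each other, so \<open>s\<close> lies below \<open>x\<close>,
        hence below the inverse of \<open>y\<close>, hence below its own inverse.\<close>
      then have "s \<le> s\<^sup>\<star>" using * triple.hyps(6) by (metis order_trans le_invol_swap)
      moreover have "s \<in> S"
      proof (rule ccontr)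
        assume "s \<notin> S"
        then have "forced S (insert s Q) \<subseteq> forced S Q" by (intro forced_mono) auto
        then show False using triple.hyps(1) 4 by auto
      qed
      ultimately show ?thesis using assms(2) forced.small by blast
    qed
  qed
qed

text \<open>Let \<open>t\<close> and its inverse be deduced with the help of \<open>s\<close>. If
  one of them is deducible without \<open>s\<close>, re-rooting the derivation of the other deduces
  the inverse of \<open>s\<close>. If neither is, \<open>s\<close> lies below both and is therefore
  small, hence forced already.\<close>

lemma forced_invol_if_contradictory_insert:
  fixes S Q :: "'u::distributive_universe set"
  assumes "separation_system_in S" "s \<in> S" "\<not> contradictory S Q" "contradictory S (insert s Q)"
  shows "s\<^sup>\<star> \<in> forced S Q"
proof -
  \<comment> \<open>Were \<open>s\<close> forced already, adding it to \<open>Q\<close> would give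
    no new deductions and hence no contradiction.\<close>
  have sn: "s \<notin> forced S Q" if "s\<^sup>\<star> \<notin> forced S Q"
  proof
    assume s: "s \<in> forced S Q"
    have "t \<in> forced S Q" if "t \<in> forced S (insert s Q)" for t
      using that
    proof induction
      case (triple x y z)
      then show ?case using forced.triple by blast
    qed (use s in \<open>auto intro: forced.given forced.small\<close>)
    with assms(3,4) show False by (auto simp: contradictory_def)
  qed
  show ?thesis
  proof (rule ccontr)
    assume n: "s\<^sup>\<star> \<notin> forced S Q"
    obtain t where t: "t \<in> forced S (insert s Q)" "t\<^sup>\<star> \<in> forced S (insert s Q)"
      using assms(4) by (auto simp: contradictory_def)
    note * = forced_insert[OF assms(1) sn[OF n] t(1)] forced_insert[OF assms(1) sn[OF n] t(2)]
    then have "s \<le> t" "s \<le> t\<^sup>\<star>"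
      using n assms(3) by (auto simp: contradictory_def)
    then have "s \<le> s\<^sup>\<star>" by (metis order_trans le_invol_swap)
    then show False using sn[OF n] assms(2) by (auto intro: forced.small)
  qed
qed

section \<open>Tangles of finite separation systems\<close>

text \<open>Each condition concerns at most three elements, and \<open>A\<close> need not be closed
  under inverses. Hence the notion passes to subsets and can be tested on finite sets, as
  compactness requires. Down-closure takes the place of consistency.\<close>

definition tangle_on :: "'a::separation_universe set \<Rightarrow> 'a set \<Rightarrow> 'a set \<Rightarrow> bool" where
  "tangle_on A Q X \<longleftrightarrow> X \<subseteq> A \<and> Q \<inter> A \<subseteq> X \<and> (\<forall>s\<in>A. s\<^sup>\<star> \<in> A \<longrightarrow> (s \<in> X \<longleftrightarrow> s\<^sup>\<star> \<notin> X)) \<and>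
    (\<forall>r\<in>A. \<forall>s\<in>X. r \<le> s \<longrightarrow> r \<in> X) \<and> (\<forall>r\<in>X. \<forall>s\<in>X. \<forall>t\<in>X. \<not> co_small (sup (sup r s) t))"

text \<open>The three pairs are uncrossed one after the other. Each step only lowers elements, so
  they stay in \<open>X\<close> and pairs made nested earlier stay nested. Two elements of the final
  star deduce the inverse of the third, which lies in \<open>X\<close>.\<close>

lemma co_small_triple_contradictory:
  fixes S X :: "'u::distributive_universe set"
  assumes "separation_system_in S" "submodular S" "X \<subseteq> S"
    and down: "\<And>p q. p \<in> S \<Longrightarrow> q \<in> X \<Longrightarrow> p \<le> q \<Longrightarrow> p \<in> X"
    and "r \<in> X" "s \<in> X" "t \<in> X" "co_small (sup (sup r s) t)"
  shows "contradictory S X"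
proof -
  have uncross: "\<exists>r'\<in>X. \<exists>s'\<in>X. r' \<le> r \<and> s' \<le> s \<and> r' \<le> s'\<^sup>\<star> \<and> co_small (sup (sup r' s') t)"
    if "r \<in> X" "s \<in> X" "co_small (sup (sup r s) t)" for r s t
  proof -
    have "inf r (s\<^sup>\<star>) \<in> S \<or> inf s (r\<^sup>\<star>) \<in> S"
      using submodular_cases assms that by blast
    then show ?thesis
    proof
      assume "inf r (s\<^sup>\<star>) \<in> S"
      then have "inf r (s\<^sup>\<star>) \<in> X" using down[of _ r] that by simp
      with that co_small_uncross[of r s t] show ?thesis
        by (intro bexI[of _ "inf r (s\<^sup>\<star>)"] bexI[of _ s]) auto
    next
      assume "inf s (r\<^sup>\<star>) \<in> S"
      then have "inf s (r\<^sup>\<star>) \<in> X" using down[of _ s] that by simp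
      with that co_small_uncross[of s r t] show ?thesis
        by (intro bexI[of _ r] bexI[of _ "inf s (r\<^sup>\<star>)"])
          (auto simp: sup_commute invol_inf intro: le_supI2)
    qed
  qed
  obtain r1 s1 where 1: "r1 \<in> X" "s1 \<in> X" "r1 \<le> s1\<^sup>\<star>" "co_small (sup (sup r1 s1) t)"
    using uncross[of r s t] assms by blast
  obtain r2 t2 where 2: "r2 \<in> X" "t2 \<in> X" "r2 \<le> r1" "r2 \<le> t2\<^sup>\<star>" "co_small (sup (sup r2 t2) s1)"
    using uncross[of r1 t s1] 1 assms(7) by (auto simp: ac_simps)
  obtain s3 t3 where 3: "s3 \<in> X" "t3 \<in> X" "s3 \<le> s1" "t3 \<le> t2" "s3 \<le> t3\<^sup>\<star>"
    "co_small (sup (sup s3 t3) r2)"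
    using uncross[of s1 t2 r2] 1 2 by (auto simp: ac_simps)
  have le: "r2 \<le> s3\<^sup>\<star>" "r2 \<le> t3\<^sup>\<star>"
    using 1 2 3 by (meson order_trans invol_antimono)+
  have "t3\<^sup>\<star> \<in> forced S X"
    by (rule forced.triple[of r2 _ _ s3])
      (use le 1 2 3 assms in \<open>auto simp: separation_system_in_def ac_simps intro!: forced.given\<close>)
  moreover have "t3 \<in> forced S X" using 3 assms by (auto intro: forced.given)
  ultimately show ?thesis by (auto simp: contradictory_def)
qed

lemma finite_tangle:
  fixes S Q :: "'u::distributive_universe set"
  assumes fin: "finite S" and inv: "separation_system_in S" and sub: "submodular S"
    and "down_closed Q" and "\<not> contradictory S Q"
  shows "\<exists>X. tangle_on S Q X"
proof -
  define P where "P = {X. X \<subseteq> S \<and> Q \<inter> S \<subseteq> X \<and> (\<forall>p\<in>S. \<forall>q\<in>X. p \<le> q \<longrightarrow> p \<in> X) \<and> \<not> contradictory S X}"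
  have "forced S (Q \<inter> S) = forced S Q"
    by (intro equalityI forced_mono) auto
  then have "Q \<inter> S \<in> P" using assms(4,5) by (auto simp: P_def contradictory_def down_closed_def)
  then have "P \<noteq> {}" by blast
  moreover have "finite P" using fin by (simp add: P_def)
  ultimately obtain X where X: "X \<in> P" and max: "\<And>Y. Y \<in> P \<Longrightarrow> X \<subseteq> Y \<Longrightarrow> X = Y"
    using finite_has_maximal[of P] by blast
  have X_in: "X \<subseteq> S" "Q \<inter> S \<subseteq> X" "\<not> contradictory S X"
    and X_down: "\<And>p q. p \<in> S \<Longrightarrow> q \<in> X \<Longrightarrow> p \<le> q \<Longrightarrow> p \<in> X"
    using X by (auto simp: P_def)
  \<comment> \<open>For a minimal \<open>r\<close> outside \<open>X\<close> below \<open>s\<close>,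
    the set \<open>insert r X\<close> is still down-closed in \<open>S\<close>. By maximality of
    \<open>X\<close> it can only fail to be in \<open>P\<close> by being contradictory.\<close>
  have low: "\<exists>r\<in>S. r \<le> s \<and> r\<^sup>\<star> \<in> forced S X" if "s \<in> S" "s \<notin> X" for s
  proof -
    let ?B = "{r \<in> S. r \<le> s \<and> r \<notin> X}"
    have "s \<in> ?B" using that by simp
    then obtain r where r: "r \<in> ?B" and rmin: "\<And>b. b \<in> ?B \<Longrightarrow> b \<le> r \<Longrightarrow> r = b"
      using finite_has_minimal[of ?B] fin by auto
    have "insert r X \<notin> P" using max[of "insert r X"] r by auto
    moreover have "p \<in> insert r X" if "p \<in> S" "p \<le> r" for p
    proof (rule ccontr)
      assume p: "p \<notin> insert r X"
      then have "p \<in> ?B" using that r order_trans[of p r s] by simp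
      from rmin[OF this that(2)] p show False by simp
    qed
    moreover have "p \<in> insert r X" if "p \<in> S" "p \<le> q" "q \<in> X" for p q
      using X_down[of p q] that by simp
    moreover have "insert r X \<subseteq> S" "Q \<inter> S \<subseteq> insert r X" using X_in r by auto
    ultimately have "contradictory S (insert r X)" unfolding P_def by blast
    then have "r\<^sup>\<star> \<in> forced S X"
      using forced_invol_if_contradictory_insert[OF inv] X_in r by auto
    then show ?thesis using r by auto
  qed
  have tot: "s \<in> X \<or> s\<^sup>\<star> \<in> X" if s: "s \<in> S" for s
  proof (rule ccontr)
    assume "\<not> (s \<in> X \<or> s\<^sup>\<star> \<in> X)"
    moreover have "s\<^sup>\<star> \<in> S" using s inv by (auto simp: separation_system_in_def)
    ultimately obtain r r' where r: "r \<le> s" "r\<^sup>\<star> \<in> forced S X" "r' \<le> s\<^sup>\<star>" "r'\<^sup>\<star> \<in> forced S X"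
      using low[of s] low[of "s\<^sup>\<star>"] s by blast
    \<comment> \<open>Through \<open>s\<close>, the two deduced inverses of \<open>r\<close> and
      \<open>r'\<close> point away from each other.\<close>
    then have "r \<le> r'\<^sup>\<star>" by (metis le_invol_swap order_trans)
    then have "contradictory S X"
      using contradictory_if_pointing_apart[OF fin inv sub _ \<open>r \<le> r'\<^sup>\<star>\<close> r(4,2)] X_down
      by blast
    then show False using X_in by simp
  qed
  have not_both: "\<not> (s \<in> X \<and> s\<^sup>\<star> \<in> X)" for s
    using X_in forced.given[of s S X] forced.given[of "s\<^sup>\<star>" S X]
    by (auto simp: contradictory_def)
  have "tangle_on S Q X"
    unfolding tangle_on_def
  proof (intro conjI ballI impI)
    show "s \<in> X \<longleftrightarrow> s\<^sup>\<star> \<notin> X" if "s \<in> S" for s using tot[OF that] not_both by blast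
    show "r \<in> X" if "r \<in> S" "s \<in> X" "r \<le> s" for r s using X_down that by blast
    show "\<not> co_small (sup (sup r s) t)" if "r \<in> X" "s \<in> X" "t \<in> X" for r s t
      using co_small_triple_contradictory[OF inv sub, of X r s t] X_in X_down that by blast
  qed (use X_in in simp_all)
  then show ?thesis ..
qed

section \<open>Compactness\<close>

text \<open>
  Zorn's lemma is applied to the sets that are, on every finite \<open>A\<close>, contained in a local solution;
  a maximal one is itself a solution on every \<open>A\<close>.
\<close>

lemma set_compactness:
  assumes local_ex: "\<And>A. finite A \<Longrightarrow> A \<subseteq> S \<Longrightarrow> \<exists>X. R A (X \<inter> A)"
    and restrict: "\<And>A B X. finite A \<Longrightarrow> A \<subseteq> S \<Longrightarrow> B \<subseteq> A \<Longrightarrow> R A (X \<inter> A) \<Longrightarrow> R B (X \<inter> B)"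
  shows "\<exists>X\<subseteq>S. \<forall>A. finite A \<longrightarrow> A \<subseteq> S \<longrightarrow> R A (X \<inter> A)"
proof -
  define \<F> where "\<F> = {X. X \<subseteq> S \<and> (\<forall>A. finite A \<longrightarrow> A \<subseteq> S \<longrightarrow> (\<exists>Y. R A (Y \<inter> A) \<and> X \<inter> A \<subseteq> Y))}"
  have "{} \<in> \<F>" using local_ex by (auto simp: \<F>_def)
  have "\<exists>M\<in>\<F>. \<forall>X\<in>\<F>. M \<subseteq> X \<longrightarrow> X = M"
  proof (rule subset_Zorn_nonempty)
    show "\<F> \<noteq> {}" using \<open>{} \<in> \<F>\<close> by blast
    fix \<C> assume \<C>: "\<C> \<noteq> {}" "subset.chain \<F> \<C>"
    have "\<exists>Y. R A (Y \<inter> A) \<and> \<Union>\<C> \<inter> A \<subseteq> Y" if A: "finite A" "A \<subseteq> S" for A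
    proof -
      have "finite (\<Union>\<C> \<inter> A)" "\<Union>\<C> \<inter> A \<subseteq> \<Union>\<C>" using A by auto
      then obtain X where X: "X \<in> \<C>" "\<Union>\<C> \<inter> A \<subseteq> X"
        using finite_subset_Union_chain[OF _ _ \<C>] by metis
      then have "X \<in> \<F>" using \<C>(2) by (auto simp: subset_chain_def)
      then obtain Y where "R A (Y \<inter> A)" "X \<inter> A \<subseteq> Y" using A by (auto simp: \<F>_def)
      then show ?thesis using X by blast
    qed
    moreover have "\<Union>\<C> \<subseteq> S" using \<C>(2) by (auto simp: subset_chain_def \<F>_def)
    ultimately show "\<Union>\<C> \<in> \<F>" by (simp add: \<F>_def)
  qed
  then obtain X where X: "X \<in> \<F>" and max: "\<And>Y. Y \<in> \<F> \<Longrightarrow> X \<subseteq> Y \<Longrightarrow> Y = X" by blast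
  have X_ex: "\<exists>Y. R A (Y \<inter> A) \<and> X \<inter> A \<subseteq> Y" if "finite A" "A \<subseteq> S" for A
    using X that by (simp add: \<F>_def)
  have "R A (X \<inter> A)" if A: "finite A" "A \<subseteq> S" for A
  proof -
    \<comment> \<open>By maximality, each \<open>a\<close> missing from \<open>X\<close> is refuted
      by a finite set on which no local solution contains the trace of
      \<open>insert a X\<close>.\<close>
    have "\<exists>B. finite B \<and> B \<subseteq> S \<and> (\<forall>Y. R B (Y \<inter> B) \<longrightarrow> \<not> insert a X \<inter> B \<subseteq> Y)"
      if "a \<in> A - X" for a
    proof -
      have "insert a X \<notin> \<F>" using max[of "insert a X"] that by auto
      moreover have "insert a X \<subseteq> S" using X that A by (auto simp: \<F>_def)
      ultimately show ?thesis by (auto simp: \<F>_def)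
    qed
    then obtain B where B: "\<And>a. a \<in> A - X \<Longrightarrow> finite (B a) \<and> B a \<subseteq> S"
      "\<And>a Y. a \<in> A - X \<Longrightarrow> R (B a) (Y \<inter> B a) \<Longrightarrow> \<not> insert a X \<inter> B a \<subseteq> Y" by metis
    \<comment> \<open>A local solution on all these finite sets together that contains the trace of
      \<open>X\<close> must omit every such \<open>a\<close>, so on \<open>A\<close> it agrees with
      \<open>X\<close>.\<close>
    let ?C = "A \<union> (\<Union>a\<in>A - X. B a)"
    have C: "finite ?C" "?C \<subseteq> S" using A B(1) by auto
    then obtain Y where Y: "R ?C (Y \<inter> ?C)" "X \<inter> ?C \<subseteq> Y"
      using X_ex[OF C] by blast
    have "a \<notin> Y" if a: "a \<in> A - X" for a
    proof
      assume "a \<in> Y"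
      have "R (B a) (Y \<inter> B a)" by (rule restrict[OF C _ Y(1)]) (use a in blast)
      with B(2)[OF a] have "\<not> insert a X \<inter> B a \<subseteq> Y" by blast
      then show False using Y(2) a \<open>a \<in> Y\<close> by blast
    qed
    then have "Y \<inter> A = X \<inter> A" using Y(2) by blast
    moreover have "R A (Y \<inter> A)" by (rule restrict[OF C _ Y(1)]) blast
    ultimately show ?thesis by simp
  qed
  moreover have "X \<subseteq> S" using X by (simp add: \<F>_def)
  ultimately show ?thesis by blast
qed

text \<open>Take all joins of meets of generators and their inverses. Distributivity gives closure
  under meets; inversion turns a join of meets into a meet of joins, which this closure
  covers.\<close>

lemma finite_subuniverse:
  fixes A :: "'u::distributive_universe set"
  assumes "finite A"
  obtains L where "finite L" "A \<subseteq> L" "\<And>x. x \<in> L \<Longrightarrow> x\<^sup>\<star> \<in> L"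
    "\<And>x y. x \<in> L \<Longrightarrow> y \<in> L \<Longrightarrow> sup x y \<in> L" "\<And>x y. x \<in> L \<Longrightarrow> y \<in> L \<Longrightarrow> inf x y \<in> L"
proof -
  define G where "G = A \<union> invol ` A"
  \<comment> \<open>Only nonempty meets and joins are formed, as the lattice may lack a top and a
    bottom.\<close>
  define I where "I = Inf_fin ` (Pow G - {{}})"
  define L where "L = Sup_fin ` (Pow I - {{}})"
  have finG: "finite G" and finI: "finite I" using assms by (auto simp: G_def I_def)
  have finL: "finite L" using finI by (auto simp: L_def)
  have supL: "sup x y \<in> L" if "x \<in> L" "y \<in> L" for x y
  proof -
    obtain B C where B: "B \<subseteq> I" "B \<noteq> {}" "x = Sup_fin B" and C: "C \<subseteq> I" "C \<noteq> {}" "y = Sup_fin C"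
      using \<open>x \<in> L\<close> \<open>y \<in> L\<close> by (auto simp: L_def)
    then have "sup x y = Sup_fin (B \<union> C)"
      using finI by (simp add: Sup_fin.union finite_subset)
    then show ?thesis using B C by (auto simp: L_def)
  qed
  have Sup_L: "Sup_fin B \<in> L" if "finite B" "B \<noteq> {}" "B \<subseteq> L" for B
    using that by (induction rule: finite_ne_induct) (auto intro: supL)
  have I_L: "I \<subseteq> L"
  proof
    fix x assume "x \<in> I"
    then show "x \<in> L" unfolding L_def by (intro image_eqI[of _ _ "{x}"]) auto
  qed
  have infI: "inf x y \<in> I" if "x \<in> I" "y \<in> I" for x y
  proof -
    obtain B C where B: "B \<subseteq> G" "B \<noteq> {}" "x = Inf_fin B" and C: "C \<subseteq> G" "C \<noteq> {}" "y = Inf_fin C"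
      using \<open>x \<in> I\<close> \<open>y \<in> I\<close> by (auto simp: I_def)
    then have "inf x y = Inf_fin (B \<union> C)"
      using finG by (simp add: Inf_fin.union finite_subset)
    then show ?thesis using B C by (auto simp: I_def)
  qed
  have infL: "inf x y \<in> L" if "x \<in> L" "y \<in> L" for x y
  proof -
    obtain B C where B: "B \<subseteq> I" "B \<noteq> {}" "x = Sup_fin B" and C: "C \<subseteq> I" "C \<noteq> {}" "y = Sup_fin C"
      using \<open>x \<in> L\<close> \<open>y \<in> L\<close> by (auto simp: L_def)
    have fin: "finite B" "finite C" using B C finI by (auto intro: finite_subset)
    let ?D = "{inf b c |b c. b \<in> B \<and> c \<in> C}"
    have "?D = (\<lambda>(b, c). inf b c) ` (B \<times> C)" by auto
    then have "finite ?D" using fin by simp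
    moreover have "?D \<noteq> {}" "?D \<subseteq> L" using B C infI I_L by blast+
    ultimately have "Sup_fin ?D \<in> L" by (intro Sup_L)
    moreover have "inf x y = Sup_fin ?D"
      using inf_Sup2_distrib[OF fin(1) B(2) fin(2) C(2)] B C by simp
    ultimately show ?thesis by simp
  qed
  have G_I: "G \<subseteq> I"
  proof
    fix x assume "x \<in> G"
    then show "x \<in> I" unfolding I_def by (intro image_eqI[of _ _ "{x}"]) auto
  qed
  have invG: "x\<^sup>\<star> \<in> G" if "x \<in> G" for x using that by (auto simp: G_def)
  have invInf: "finite B \<Longrightarrow> B \<noteq> {} \<Longrightarrow> B \<subseteq> G \<Longrightarrow> (Inf_fin B)\<^sup>\<star> \<in> L" for B
    by (induction rule: finite_ne_induct)
      (use G_I I_L invG in \<open>auto simp: invol_inf intro!: supL\<close>)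
  have invI: "x\<^sup>\<star> \<in> L" if "x \<in> I" for x
    using that invInf finG by (auto simp: I_def intro: finite_subset)
  have invSup: "finite B \<Longrightarrow> B \<noteq> {} \<Longrightarrow> B \<subseteq> I \<Longrightarrow> (Sup_fin B)\<^sup>\<star> \<in> L" for B
    by (induction rule: finite_ne_induct) (use invI in \<open>auto simp: invol_sup intro!: infL\<close>)
  have invL: "x\<^sup>\<star> \<in> L" if "x \<in> L" for x
    using that invSup finI by (auto simp: L_def intro: finite_subset)
  have "A \<subseteq> L" using G_I I_L by (auto simp: G_def)
  then show ?thesis using that[OF finL _ invL supL infL] by blast
qed

section \<open>Restricting tangles and assembling them from finite pieces\<close>

lemma tangle_onD:
  assumes "tangle_on A Q X"
  shows "X \<subseteq> A" "Q \<inter> A \<subseteq> X"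
    and "s \<in> A \<Longrightarrow> s\<^sup>\<star> \<in> A \<Longrightarrow> s \<in> X \<longleftrightarrow> s\<^sup>\<star> \<notin> X"
    and "r \<in> A \<Longrightarrow> s \<in> X \<Longrightarrow> r \<le> s \<Longrightarrow> r \<in> X"
    and "r \<in> X \<Longrightarrow> s \<in> X \<Longrightarrow> t \<in> X \<Longrightarrow> \<not> co_small (sup (sup r s) t)"
proof -
  have *: "X \<subseteq> A" "Q \<inter> A \<subseteq> X" "\<forall>s\<in>A. s\<^sup>\<star> \<in> A \<longrightarrow> (s \<in> X \<longleftrightarrow> s\<^sup>\<star> \<notin> X)"
    "\<forall>r\<in>A. \<forall>s\<in>X. r \<le> s \<longrightarrow> r \<in> X"
    "\<forall>r\<in>X. \<forall>s\<in>X. \<forall>t\<in>X. \<not> co_small (sup (sup r s) t)"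
    using assms unfolding tangle_on_def by - (elim conjE, assumption)+
  show "X \<subseteq> A" "Q \<inter> A \<subseteq> X" by (fact *)+
  show "s \<in> A \<Longrightarrow> s\<^sup>\<star> \<in> A \<Longrightarrow> s \<in> X \<longleftrightarrow> s\<^sup>\<star> \<notin> X" using *(3) by blast
  show "r \<in> A \<Longrightarrow> s \<in> X \<Longrightarrow> r \<le> s \<Longrightarrow> r \<in> X" using *(4) by blast
  show "r \<in> X \<Longrightarrow> s \<in> X \<Longrightarrow> t \<in> X \<Longrightarrow> \<not> co_small (sup (sup r s) t)" using *(5) by blast
qed

lemma tangle_on_restrict:
  assumes "tangle_on A Q (X \<inter> A)" "B \<subseteq> A"
  shows "tangle_on B Q (X \<inter> B)"
  unfolding tangle_on_def
proof (intro conjI ballI impI)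
  show "X \<inter> B \<subseteq> B" by simp
  show "Q \<inter> B \<subseteq> X \<inter> B" using tangle_onD(2)[OF assms(1)] assms(2) by blast
next
  fix s assume "s \<in> B" "s\<^sup>\<star> \<in> B"
  then show "s \<in> X \<inter> B \<longleftrightarrow> s\<^sup>\<star> \<notin> X \<inter> B"
    using tangle_onD(3)[OF assms(1), of s] assms(2) by blast
next
  fix r s assume "r \<in> B" "s \<in> X \<inter> B" "r \<le> s"
  then show "r \<in> X \<inter> B" using tangle_onD(4)[OF assms(1), of r s] assms(2) by blast
next
  fix r s t assume "r \<in> X \<inter> B" "s \<in> X \<inter> B" "t \<in> X \<inter> B"
  then show "\<not> co_small (sup (sup r s) t)"
    using tangle_onD(5)[OF assms(1), of r s t] assms(2) by blast
qed

lemma tangle_on_if_finite_tangles: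
  assumes "X \<subseteq> S" and fin: "\<And>A. finite A \<Longrightarrow> A \<subseteq> S \<Longrightarrow> tangle_on A Q (X \<inter> A)"
  shows "tangle_on S Q X"
  unfolding tangle_on_def
proof (intro conjI ballI impI)
  show "Q \<inter> S \<subseteq> X"
  proof
    fix s assume "s \<in> Q \<inter> S"
    with tangle_onD(2)[OF fin[of "{s}"]] show "s \<in> X" by auto
  qed
next
  fix s assume s: "s \<in> S" "s\<^sup>\<star> \<in> S"
  have "tangle_on {s, s\<^sup>\<star>} Q (X \<inter> {s, s\<^sup>\<star>})" using fin s by simp
  from tangle_onD(3)[OF this, of s] show "s \<in> X \<longleftrightarrow> s\<^sup>\<star> \<notin> X" by blast
next
  fix r s assume rs: "r \<in> S" "s \<in> X" "r \<le> s"
  then have "tangle_on {r, s} Q (X \<inter> {r, s})"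
    by (intro fin) (use \<open>X \<subseteq> S\<close> in auto)
  from tangle_onD(4)[OF this, of r s] rs show "r \<in> X" by blast
next
  fix r s t assume rst: "r \<in> X" "s \<in> X" "t \<in> X"
  then have "tangle_on {r, s, t} Q (X \<inter> {r, s, t})"
    by (intro fin) (use \<open>X \<subseteq> S\<close> in auto)
  from tangle_onD(5)[OF this, of r s t] rst show "\<not> co_small (sup (sup r s) t)" by blast
qed (rule \<open>X \<subseteq> S\<close>)

lemma tangle_if_not_contradictory:
  fixes S Q :: "'u::distributive_universe set"
  assumes "separation_system_in S" "submodular S" "down_closed Q" "\<not> contradictory S Q"
  shows "\<exists>X. tangle_on S Q X"
proof -
  have "\<exists>X. tangle_on A Q (X \<inter> A)" if A: "finite A" "A \<subseteq> S" for A
  proof -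
    obtain L where L: "finite L" "A \<subseteq> L" "\<And>x. x \<in> L \<Longrightarrow> x\<^sup>\<star> \<in> L"
      "\<And>x y. x \<in> L \<Longrightarrow> y \<in> L \<Longrightarrow> sup x y \<in> L" "\<And>x y. x \<in> L \<Longrightarrow> y \<in> L \<Longrightarrow> inf x y \<in> L"
      using finite_subuniverse[OF A(1)] by metis
    \<comment> \<open>The finite system \<open>S \<inter> L\<close> has no more deductions than
      \<open>S\<close>, and it stays submodular because \<open>L\<close> is closed under joins and
      meets.\<close>
    have "forced (S \<inter> L) Q \<subseteq> forced S Q" by (rule forced_mono) auto
    then have "\<not> contradictory (S \<inter> L) Q" using assms(4) by (auto simp: contradictory_def)
    moreover have "separation_system_in (S \<inter> L)"
      using assms(1) L(3) by (auto simp: separation_system_in_def)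
    moreover have "submodular (S \<inter> L)"
      using assms(2) L(4,5) unfolding submodular_def by blast
    ultimately obtain X where "tangle_on (S \<inter> L) Q X"
      using finite_tangle[of "S \<inter> L" Q] assms(3) L(1) by blast
    moreover from this have "X \<inter> (S \<inter> L) = X" by (auto simp: tangle_on_def)
    ultimately have "tangle_on (S \<inter> L) Q (X \<inter> (S \<inter> L))" by simp
    then have "tangle_on A Q (X \<inter> A)" by (rule tangle_on_restrict) (use A L in blast)
    then show ?thesis ..
  qed
  then have "\<exists>X\<subseteq>S. \<forall>A. finite A \<longrightarrow> A \<subseteq> S \<longrightarrow> tangle_on A Q (X \<inter> A)"
    by (rule set_compactness) (auto intro: tangle_on_restrict)
  then show ?thesis using tangle_on_if_finite_tangles by blast
qed

lemma abstract_tangle_if_tangle_on: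
  assumes "separation_system_in S" "\<forall>s\<in>S. \<not> degenerate s" "tangle_on S Q X"
  shows "abstract_tangle S X \<and> extends S X Q"
proof -
  note tangle = tangle_onD[OF assms(3)]
  have or: "s \<in> X \<longleftrightarrow> s\<^sup>\<star> \<notin> X" if "s \<in> S" for s
    using tangle(3)[OF that] assms(1) that by (auto simp: separation_system_in_def)
  have "\<exists>!x. x \<in> unoriented s \<and> x \<in> X" if "s \<in> S" for s
  proof (cases "s \<in> X")
    case True
    then show ?thesis using or[OF that] by (intro ex1I[of _ s]) (auto simp: unoriented_def)
  next
    case False
    then show ?thesis using or[OF that] by (intro ex1I[of _ "s\<^sup>\<star>"]) (auto simp: unoriented_def)
  qed
  then have "orientation_of S X" using tangle(1) by (auto simp: orientation_of_def)
  moreover have "consistent S X"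
    unfolding consistent_def
  proof (intro ballI impI)
    fix r s assume "r \<in> S" "s \<in> X" "r \<le> s"
    then have "r \<in> X" by (rule tangle(4))
    then show "r\<^sup>\<star> \<notin> X" using or[OF \<open>r \<in> S\<close>] by simp
  qed
  moreover have "\<sigma> \<notin> cosmall_triples" if "\<sigma> \<subseteq> X" for \<sigma>
    using that tangle(5) by (auto simp: cosmall_triples_def)
  ultimately show ?thesis
    using tangle(2) by (simp add: abstract_tangle_def extends_def)
qed

section \<open>From derivations to S-trees\<close>

text \<open>
  Trees are coded by a parent function \<open>p\<close> on a set of natural numbers with root \<open>0\<close>, where \<open>p\<close>
  decreases; \<open>\<beta> v\<close> labels the arc from \<open>v\<close> to \<open>p v\<close> (the values of \<open>p\<close> and \<open>\<beta>\<close> at \<open>0\<close> are irrelevant).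
  The condition on the root is left open, so that further branches can be grafted there.
\<close>

definition child_labels :: "nat set \<Rightarrow> (nat \<Rightarrow> nat) \<Rightarrow> (nat \<Rightarrow> 'a) \<Rightarrow> nat \<Rightarrow> 'a set" where
  "child_labels V p \<beta> v = \<beta> ` {c \<in> V. c \<noteq> 0 \<and> p c = v}"

definition rooted_tree ::
  "'a::separation_system set \<Rightarrow> 'a set set \<Rightarrow> nat set \<Rightarrow> (nat \<Rightarrow> nat) \<Rightarrow> (nat \<Rightarrow> 'a) \<Rightarrow> bool" where
  "rooted_tree S F V p \<beta> \<longleftrightarrow> finite V \<and> 0 \<in> V \<and>
    (\<forall>v\<in>V. v \<noteq> 0 \<longrightarrow> p v \<in> V \<and> p v < v \<and> \<beta> v \<in> S \<and>
      insert ((\<beta> v)\<^sup>\<star>) (child_labels V p \<beta> v) \<in> F)"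

definition branching :: "'a::separation_system set \<Rightarrow> 'a set set \<Rightarrow> 'a set \<Rightarrow> bool" where
  "branching S F K \<longleftrightarrow> (\<exists>V p \<beta>. rooted_tree S F V p \<beta> \<and> child_labels V p \<beta> 0 = K)"

lemma branching_empty: "branching S F {}"
  unfolding branching_def rooted_tree_def
  by (intro exI[of _ "{0}"]) (auto simp: child_labels_def)

text \<open>The second tree is hung from the root of the first by an edge labelled \<open>s\<close>.
  Even numbers name the first tree and odd ones the second, which keeps parents smaller than
  children; the second root becomes the vertex \<open>1\<close>, a child of
  \<open>0\<close>.\<close>

lemma branching_graft:
  assumes "branching S F K" "branching S F K'" "s \<in> S" "insert (s\<^sup>\<star>) K' \<in> F"
  shows "branching S F (insert s K)"
proof -
  obtain V1 p1 \<beta>1 where 1: "rooted_tree S F V1 p1 \<beta>1" "child_labels V1 p1 \<beta>1 0 = K"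
    using assms(1) by (auto simp: branching_def)
  obtain V2 p2 \<beta>2 where 2: "rooted_tree S F V2 p2 \<beta>2" "child_labels V2 p2 \<beta>2 0 = K'"
    using assms(2) by (auto simp: branching_def)
  define V where "V = (\<lambda>n. 2 * n) ` V1 \<union> (\<lambda>n. Suc (2 * n)) ` V2"
  define p where "p v = (if v = 1 then 0 else if even v then 2 * p1 (v div 2)
    else Suc (2 * p2 (v div 2)))" for v
  define \<beta> where "\<beta> v = (if v = 1 then s else if even v then \<beta>1 (v div 2) else \<beta>2 (v div 2))" for v
  have p1: "p (2 * n) = 2 * p1 n" "\<beta> (2 * n) = \<beta>1 n" for n
    by (auto simp: p_def \<beta>_def)
  have p2: "p (Suc (2 * n)) = (if n = 0 then 0 else Suc (2 * p2 n))"
    "\<beta> (Suc (2 * n)) = (if n = 0 then s else \<beta>2 n)" for n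
    by (auto simp: p_def \<beta>_def)
  have p3: "p (Suc 0) = 0" "\<beta> (Suc 0) = s" by (auto simp: p_def \<beta>_def)
  have ne: "Suc (2 * m) \<noteq> 2 * n" "2 * n \<noteq> Suc (2 * m)" for m n :: nat by presburger+
  have kids: "{c \<in> V. c \<noteq> 0 \<and> p c = v} = (\<lambda>n. 2 * n) ` {c \<in> V1. c \<noteq> 0 \<and> 2 * p1 c = v}
      \<union> (\<lambda>n. Suc (2 * n)) ` {c \<in> V2. (if c = 0 then 0 else Suc (2 * p2 c)) = v}" for v
    by (auto simp: V_def p1 p2 p3 split: if_splits)
  have kids1: "child_labels V p \<beta> (2 * n) = (if n = 0 then insert s K else child_labels V1 p1 \<beta>1 n)" for n
  proof -
    have "{c \<in> V2. (if c = 0 then 0 else Suc (2 * p2 c)) = 2 * n} = (if n = 0 then {0} else {})"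
      using 2(1) by (auto simp: ne rooted_tree_def split: if_splits)
    then have "child_labels V p \<beta> (2 * n) = child_labels V1 p1 \<beta>1 n
        \<union> (\<lambda>c. if c = 0 then s else \<beta>2 c) ` (if n = 0 then {0} else {})"
      unfolding child_labels_def kids by (simp add: image_Un image_image p1 p2)
    then show ?thesis using 1(2) by simp
  qed
  have kids2: "child_labels V p \<beta> (Suc (2 * n)) = child_labels V2 p2 \<beta>2 n" for n
  proof -
    have "{c \<in> V1. c \<noteq> 0 \<and> 2 * p1 c = Suc (2 * n)} = {}" by (auto simp: ne)
    moreover have "{c \<in> V2. (if c = 0 then 0 else Suc (2 * p2 c)) = Suc (2 * n)}
        = {c \<in> V2. c \<noteq> 0 \<and> p2 c = n}" by auto
    ultimately have "child_labels V p \<beta> (Suc (2 * n))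
        = (\<lambda>c. if c = 0 then s else \<beta>2 c) ` {c \<in> V2. c \<noteq> 0 \<and> p2 c = n}"
      unfolding child_labels_def kids by (simp only: image_Un image_image image_empty Un_empty_left p2)
    also have "\<dots> = child_labels V2 p2 \<beta>2 n"
      unfolding child_labels_def by (rule image_cong) auto
    finally show ?thesis .
  qed
  have "rooted_tree S F V p \<beta>"
    unfolding rooted_tree_def
  proof (intro conjI ballI impI)
    show "finite V" "0 \<in> V" using 1(1) 2(1) by (auto simp: V_def rooted_tree_def)
    fix v assume "v \<in> V" "v \<noteq> 0"
    then consider n where "v = 2 * n" "n \<in> V1" "n \<noteq> 0" | "v = Suc (2 * 0)"
      | n where "v = Suc (2 * n)" "n \<in> V2" "n \<noteq> 0" by (auto simp: V_def) (metis neq0_conv)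
    then have "p v \<in> V \<and> p v < v \<and> \<beta> v \<in> S \<and> insert ((\<beta> v)\<^sup>\<star>) (child_labels V p \<beta> v) \<in> F"
    proof cases
      case 1
      then show ?thesis using \<open>rooted_tree S F V1 p1 \<beta>1\<close>
        by (simp add: kids1 p1) (simp add: V_def rooted_tree_def)
    next
      case 2
      then show ?thesis using assms(3,4) \<open>0 \<in> V\<close> \<open>child_labels V2 p2 \<beta>2 0 = K'\<close>
        by (simp only: kids2 p2) simp
    next
      case 3
      then show ?thesis using \<open>rooted_tree S F V2 p2 \<beta>2\<close>
        by (simp add: kids2 p2) (simp add: V_def rooted_tree_def)
    qed
    then show "p v \<in> V" "p v < v" "\<beta> v \<in> S" "insert ((\<beta> v)\<^sup>\<star>) (child_labels V p \<beta> v) \<in> F"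
      by auto
  qed
  moreover have "child_labels V p \<beta> 0 = insert s K" using kids1[of 0] by simp
  ultimately show ?thesis by (auto simp: branching_def)
qed

lemma triple_star:
  fixes S :: "'u::distributive_universe set"
  assumes "\<forall>s\<in>S. \<not> degenerate s" "x \<in> S" "y \<in> S" "z\<^sup>\<star> \<in> S"
    "x \<le> z" "y \<le> z" "x = y \<or> x \<le> y\<^sup>\<star>" "co_small (sup (sup x y) (z\<^sup>\<star>))"
  shows "{x, y, z\<^sup>\<star>} \<in> cosmall_triple_stars"
proof -
  have "{x, y, z\<^sup>\<star>} \<in> cosmall_triples" using assms(8) by (auto simp: cosmall_triples_def)
  moreover have "star {x, y, z\<^sup>\<star>}"
    using assms le_invol_swap[of x y] by (auto simp: star_def)
  ultimately show ?thesis by (simp add: cosmall_triple_stars_def)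
qed

text \<open>Rules become nodes: \<open>given\<close> and \<open>small\<close> are leaves, and
  \<open>triple\<close> grafts the branches of its premises. The root is the inner end of the
  dangling edge, which adds the inverse of \<open>s\<close> to its incoming labels.\<close>

lemma branching_if_forced:
  fixes S Q :: "'u::distributive_universe set"
  defines "F \<equiv> cosmall_triple_stars \<union> forced_singletons Q"
  assumes "separation_system_in S" "\<forall>s\<in>S. \<not> degenerate s" "s \<in> forced S Q"
  shows "\<exists>K. branching S F K \<and> insert (s\<^sup>\<star>) K \<in> F"
  using assms(4)
proof induction
  case (given s)
  then have "{s\<^sup>\<star>} \<in> F" using assms(3) by (auto simp: F_def forced_singletons_def)
  then show ?case using branching_empty by blast
next
  case (small s)
  then have "s\<^sup>\<star> \<in> S" using assms(2) by (simp add: separation_system_in_def)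
  \<comment> \<open>The leaf of a small separation is a triple with three equal entries.\<close>
  moreover have "co_small (sup (sup (s\<^sup>\<star>) (s\<^sup>\<star>)) (s\<^sup>\<star>))" using small by (simp add: co_small_def)
  ultimately have "{s\<^sup>\<star>} \<in> cosmall_triple_stars"
    using assms(3) by (auto simp: cosmall_triple_stars_def cosmall_triples_def star_def)
  then show ?case using branching_empty unfolding F_def by blast
next
  case (triple x y z)
  then have "x \<in> S" "y \<in> S" "z\<^sup>\<star> \<in> S"
    using forced_in assms(2) by (auto simp: separation_system_in_def)
  then have "{x, y, z\<^sup>\<star>} \<in> F"
    using triple_star[OF assms(3)] triple.hyps unfolding F_def by blast
  moreover have "{x, y, z\<^sup>\<star>} = insert (z\<^sup>\<star>) {x, y}" by auto
  moreover obtain K where "branching S F K" "insert (x\<^sup>\<star>) K \<in> F" using triple.IH by blast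
  moreover obtain L where "branching S F L" "insert (y\<^sup>\<star>) L \<in> F" using triple.IH by blast
  ultimately show ?case
    using branching_graft[OF branching_graft[OF branching_empty]] \<open>x \<in> S\<close> \<open>y \<in> S\<close> by metis
qed

text \<open>Identifying the dangling edges of the two derivations completes the star at each of
  their roots.\<close>

lemma branching_if_contradictory:
  fixes S Q :: "'u::distributive_universe set"
  defines "F \<equiv> cosmall_triple_stars \<union> forced_singletons Q"
  assumes "separation_system_in S" "\<forall>s\<in>S. \<not> degenerate s" "contradictory S Q"
  shows "\<exists>K\<in>F. branching S F K"
proof -
  obtain s where s: "s \<in> forced S Q" "s\<^sup>\<star> \<in> forced S Q" using assms(4) by (auto simp: contradictory_def)
  obtain K where K: "branching S F K" "insert (s\<^sup>\<star>) K \<in> F"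
    using branching_if_forced[OF assms(2,3) s(1)] by (auto simp: F_def)
  obtain L where L: "branching S F L" "insert ((s\<^sup>\<star>)\<^sup>\<star>) L \<in> F"
    using branching_if_forced[OF assms(2,3) s(2)] by (auto simp: F_def)
  show ?thesis
    using branching_graft[OF K(1) L(1) forced_in[OF s(2)] L(2)] K(2) by blast
qed

section \<open>Cycles and sinks\<close>

lemma pcas_nth:
  assumes "pcas u q v"
  shows "\<And>i. Suc i < length q \<Longrightarrow> snd (q ! i) = fst (q ! Suc i)"
    and "q \<noteq> [] \<Longrightarrow> fst (q ! 0) = u \<and> snd (q ! (length q - 1)) = v"
proof -
  have "(\<forall>i. Suc i < length q \<longrightarrow> snd (q ! i) = fst (q ! Suc i)) \<and>
    (q \<noteq> [] \<longrightarrow> fst (q ! 0) = u \<and> snd (q ! (length q - 1)) = v)"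
    using assms
  proof (induction q arbitrary: u)
    case (Cons e q)
    then have IH: "\<And>i. Suc i < length q \<Longrightarrow> snd (q ! i) = fst (q ! Suc i)"
      "q \<noteq> [] \<Longrightarrow> fst (q ! 0) = snd e \<and> snd (q ! (length q - 1)) = v" by auto
    have "snd ((e # q) ! i) = fst ((e # q) ! Suc i)" if "Suc i < length (e # q)" for i
      using IH that by (cases i) auto
    then show ?case using Cons.prems IH(2) by (cases "q = []") (auto simp: nth_Cons')
  qed simp
  then show "\<And>i. Suc i < length q \<Longrightarrow> snd (q ! i) = fst (q ! Suc i)"
    "q \<noteq> [] \<Longrightarrow> fst (q ! 0) = u \<and> snd (q ! (length q - 1)) = v" by auto
qed

text \<open>The vertices of a walk after its first one are the heads of its arcs.\<close>

lemma cycle_with_proj_iff: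
  "pre_digraph.cycle (with_proj T) q \<longleftrightarrow>
    (\<exists>u\<in>pverts T. set q \<subseteq> parcs T \<and> pcas u q u) \<and> distinct (map snd q) \<and> q \<noteq> []"
proof -
  have "tl (pre_digraph.awalk_verts (with_proj T) u q) = map snd q"
    if "pcas u q u" "q \<noteq> []" for u
    using pre_digraph.awalk_verts_conv'[of "with_proj T" u q u] that by (simp add: cas_with_proj_eq)
  then show ?thesis
    by (auto simp: pre_digraph.cycle_def pre_digraph.awalk_def cas_with_proj_eq)
qed

text \<open>The largest vertex of a cycle would have its parent as both neighbours.\<close>

lemma parent_arcs_no_cycle:
  fixes T :: "nat pair_pre_digraph"
  assumes arcs: "\<And>x y. (x, y) \<in> parcs T \<Longrightarrow> x < y \<and> p y = x \<or> y < x \<and> p x = y"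
    and "pre_digraph.cycle (with_proj T) q" "length q \<ge> 3"
  shows False
proof -
  let ?n = "length q"
  obtain u where q: "set q \<subseteq> parcs T" "pcas u q u" "distinct (map snd q)" "q \<noteq> []"
    using assms(2) by (auto simp: cycle_with_proj_iff)
  note nth = pcas_nth[OF q(2)]
  define h where "h i = snd (q ! i)" for i
  have h_inj: "h i \<noteq> h j" if "i < ?n" "j < ?n" "i \<noteq> j" for i j
    using q(3) that by (auto simp: distinct_conv_nth h_def)
  have "Max (snd ` set q) \<in> snd ` set q" using q(4) by (intro Max_in) auto
  then obtain i where i: "i < ?n" "h i = Max (snd ` set q)" by (auto simp: in_set_conv_nth h_def)
  have h_max: "h j \<le> h i" if "j < ?n" for j
    unfolding i(2) using that by (auto simp: h_def intro!: Max_ge)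
  have arc: "(h j, h k) \<in> parcs T" if "k < ?n" "k = (if j = ?n - 1 then 0 else Suc j)" "j < ?n" for j k
  proof -
    have "fst (q ! k) = h j" using nth(1)[of j] nth(2) q(4) that by (auto simp: h_def)
    then have "q ! k = (h j, h k)" by (simp add: h_def prod_eq_iff)
    then show ?thesis using q(1) that(1) by (metis nth_mem subsetD)
  qed
  \<comment> \<open>The cyclic successor and predecessor of \<open>i\<close>; they differ because
    the cycle has length at least 3.\<close>
  define k where "k = (if i = ?n - 1 then 0 else Suc i)"
  define j where "j = (if i = 0 then ?n - 1 else i - 1)"
  have jk: "j < ?n" "k < ?n" "j \<noteq> k" using i(1) assms(3) by (auto simp: j_def k_def)
  have "(h j, h i) \<in> parcs T" by (rule arc) (use i(1) jk in \<open>auto simp: j_def\<close>)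
  then have "h j = p (h i)" using arcs[of "h j" "h i"] h_max[OF jk(1)] by auto
  moreover have "(h i, h k) \<in> parcs T" by (rule arc) (use i(1) jk in \<open>auto simp: k_def\<close>)
  then have "h k = p (h i)" using arcs[of "h i" "h k"] h_max[OF jk(2)] by auto
  ultimately show False using h_inj jk by metis
qed

lemma S_tree_if_branching:
  assumes "branching S F K" "K \<in> F" and inv: "separation_system_in S"
  shows "has_S_tree_over S F"
proof -
  obtain V p \<beta> where V: "rooted_tree S F V p \<beta>" "child_labels V p \<beta> 0 = K"
    using assms(1) by (auto simp: branching_def)
  have par: "p v \<in> V" "p v < v" "\<beta> v \<in> S" "insert ((\<beta> v)\<^sup>\<star>) (child_labels V p \<beta> v) \<in> F"
    if "v \<in> V" "v \<noteq> 0" for v using V(1) that by (auto simp: rooted_tree_def)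
  have fin: "finite V" "0 \<in> V" using V(1) by (auto simp: rooted_tree_def)
  define T where "T = \<lparr>pverts = V, parcs = {(x, y). x \<in> V \<and> y \<in> V \<and> (x < y \<and> p y = x \<or> y < x \<and> p x = y)}\<rparr>"
  \<comment> \<open>Parents are smaller, so comparing the ends of an arc tells which one is the
    child.\<close>
  define \<alpha> where "\<alpha> = (\<lambda>(x, y). if y < x then \<beta> x else (\<beta> y)\<^sup>\<star>)"
  have T: "pverts T = V"
    "(x, y) \<in> parcs T \<longleftrightarrow> x \<in> V \<and> y \<in> V \<and> (x < y \<and> p y = x \<or> y < x \<and> p x = y)" for x y
    by (auto simp: T_def)
  have "finite (parcs T)" by (rule finite_subset[of _ "V \<times> V"]) (use fin in \<open>auto simp: T_def\<close>)
  then have graph: "pair_graph T"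
    using fin by unfold_locales (auto simp: T symmetric_def intro!: symI)
  let ?G = "mk_symmetric (with_proj T)"
  \<comment> \<open>Connectedness is stated through the symmetric closure; parent arcs lead from
    every vertex to \<open>0\<close>.\<close>
  have reach0: "v \<rightarrow>\<^sup>*\<^bsub>?G\<^esub> 0" if "v \<in> V" for v
    using that
  proof (induction v rule: less_induct)
    case (less v)
    show ?case
    proof (cases "v = 0")
      case True
      then show ?thesis using less.prems by (simp add: reachable_def T)
    next
      case False
      then have "(v, p v) \<in> parcs T" using par[of v] less.prems by (auto simp: T)
      then have "(v, p v) \<in> parcs ?G" by (force simp: parcs_mk_symmetric)
      then show ?thesis
        using less.IH[of "p v"] par[of v] False less.prems
        by (auto simp: reachable_def T intro: converse_rtrancl_on_into_rtrancl_on)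
    qed
  qed
  have "connected (with_proj T)"
    unfolding connected_def strongly_connected_def
  proof (intro conjI ballI)
    fix u v assume "u \<in> verts ?G" "v \<in> verts ?G"
    then have "u \<rightarrow>\<^sup>*\<^bsub>?G\<^esub> 0" "v \<rightarrow>\<^sup>*\<^bsub>?G\<^esub> 0" using reach0 by (simp_all add: T)
    from this(1) symmetric_reachable[OF symmetric_mk_symmetric this(2)] show "u \<rightarrow>\<^sup>*\<^bsub>?G\<^esub> v" unfolding reachable_def by (rule rtrancl_on_trans)
  qed (use fin in \<open>auto simp: T\<close>)
  moreover have "\<not> (\<exists>q. pre_digraph.cycle (with_proj T) q \<and> length q \<ge> 3)"
    using parent_arcs_no_cycle[of T p] by (auto simp: T)
  ultimately have "undirected_tree T" using graph by (simp add: undirected_tree_def)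
  moreover have "\<alpha> e \<in> S" if "e \<in> parcs T" for e
    using that par inv by (cases e) (auto simp: T \<alpha>_def separation_system_in_def)
  moreover have "\<alpha> (y, x) = (\<alpha> (x, y))\<^sup>\<star>" if "(x, y) \<in> parcs T" for x y
    using that by (auto simp: T \<alpha>_def)
  ultimately have "S_tree S T \<alpha>" by (auto simp: S_tree_def)
  moreover have "\<alpha> ` in_arcs (with_proj T) v \<in> F" if "v \<in> V" for v
  proof -
    have "in_arcs (with_proj T) v = (\<lambda>c. (c, v)) ` {c \<in> V. c \<noteq> 0 \<and> p c = v}
        \<union> (if v = 0 then {} else {(p v, v)})"
      using par that by (auto simp: in_arcs_def T)
    moreover have "\<alpha> (c, v) = \<beta> c" if "c \<in> V" "c \<noteq> 0" "p c = v" for c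
      using par(2)[OF that(1,2)] that(3) by (simp add: \<alpha>_def)
    then have "\<alpha> ` (\<lambda>c. (c, v)) ` {c \<in> V. c \<noteq> 0 \<and> p c = v} = child_labels V p \<beta> v"
      unfolding image_image child_labels_def by (intro image_cong) auto
    moreover have "\<alpha> (p v, v) = (\<beta> v)\<^sup>\<star>" if "v \<noteq> 0"
      using par(2)[OF \<open>v \<in> V\<close> that] by (simp add: \<alpha>_def)
    ultimately have "\<alpha> ` in_arcs (with_proj T) v = child_labels V p \<beta> v
        \<union> (if v = 0 then {} else {(\<beta> v)\<^sup>\<star>})"
      by (simp add: image_Un)
    then show ?thesis using par(4)[OF that] V(2) assms(2) by (cases "v = 0") auto
  qed
  ultimately show ?thesis unfolding has_S_tree_over_def S_tree_over_def T(1)[symmetric] by blast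
qed

text \<open>Otherwise an arc of \<open>R\<close> could be followed out of every vertex. In a finite
  graph this walk returns to some vertex, and a shortest return is a cycle.\<close>

lemma undirected_tree_has_sink:
  assumes "undirected_tree T" and out: "\<And>x y. (x, y) \<in> R \<Longrightarrow> (x, y) \<in> parcs T"
    and asym: "\<And>x y. (x, y) \<in> R \<Longrightarrow> (y, x) \<notin> R"
  shows "\<exists>t\<in>pverts T. \<forall>y. (t, y) \<notin> R"
proof (rule ccontr)
  assume n: "\<not> ?thesis"
  interpret pair_graph T using assms(1) by (simp add: undirected_tree_def)
  obtain f where f: "\<And>t. t \<in> pverts T \<Longrightarrow> (t, f t) \<in> R" using n by metis
  have f_in: "f t \<in> pverts T" if "t \<in> pverts T" for t
    using out[OF f[OF that]] in_arcsD2 by blast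
  have iter_in: "(f ^^ i) t \<in> pverts T" if "t \<in> pverts T" for i t
    using that by (induction i) (auto intro: f_in)
  obtain t0 where t0: "t0 \<in> pverts T"
    using assms(1) by (auto simp: undirected_tree_def connected_def strongly_connected_def)
  have "finite (range (\<lambda>i. (f ^^ i) t0))"
    by (rule finite_subset[OF _ pair_finite_verts]) (use iter_in[OF t0] in auto)
  then have "\<not> inj (\<lambda>i. (f ^^ i) t0)" using finite_imageD infinite_UNIV_nat by blast
  then obtain i j where ij: "i < j" "(f ^^ i) t0 = (f ^^ j) t0"
    unfolding inj_def by (metis nat_neq_iff)
  define v where "v = (f ^^ i) t0"
  have v: "v \<in> pverts T" unfolding v_def by (rule iter_in[OF t0])
  define k where "k = (LEAST k. 0 < k \<and> (f ^^ k) v = v)"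
  have "(f ^^ (j - i)) v = (f ^^ (j - i + i)) t0" by (simp only: v_def funpow_add comp_def)
  also have "\<dots> = v" using ij by (simp add: v_def)
  finally have "(f ^^ (j - i)) v = v" .
  then have "0 < j - i \<and> (f ^^ (j - i)) v = v" using ij by simp
  then have k: "0 < k \<and> (f ^^ k) v = v" unfolding k_def by (rule LeastI)
  have k_min: "\<not> (0 < l \<and> (f ^^ l) v = v)" if "l < k" for l
    using not_less_Least that unfolding k_def by blast
  define g where "g l = (f ^^ l) v" for l
  have g_Suc: "g (Suc l) = f (g l)" for l by (simp add: g_def)
  have g_R: "(g l, g (Suc l)) \<in> R" for l
    unfolding g_Suc using f iter_in[OF v] by (simp add: g_def)
  have g_add: "g (m + l) = (f ^^ m) (g l)" for m l by (simp add: g_def funpow_add)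
  have g_inj: "g a \<noteq> g b" if "a < b" "b < k" for a b
  proof
    assume "g a = g b"
    \<comment> \<open>Moving both points on by \<open>k - b\<close> steps brings \<open>g b\<close>
      back to \<open>v\<close>, so \<open>g a\<close> would give a return in fewer than
      \<open>k\<close> steps.\<close>
    then have "g (k - b + a) = g (k - b + b)" by (simp only: g_add)
    also have "\<dots> = v" using that k by (simp add: g_def)
    finally have "(f ^^ (k - b + a)) v = v" by (simp only: g_def)
    moreover have "0 < k - b + a" "k - b + a < k" using that by linarith+
    ultimately show False using k_min by blast
  qed
  \<comment> \<open>A loop or a step back and forth would violate asymmetry.\<close>
  have "k \<noteq> 1" using g_R[of 0] asym[of "g 0" "g 1"] k by (auto simp: g_def)
  moreover have "k \<noteq> 2"
    using g_R[of 0] g_R[of 1] asym[of "g 0" "g 1"] k by (auto simp: g_def numeral_2_eq_2)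
  ultimately have "3 \<le> k" using k by linarith
  let ?q = "map (\<lambda>l. (g l, g (Suc l))) [0..<k]"
  have "pcas (g a) (map (\<lambda>l. (g l, g (Suc l))) [a..<k]) (g k)" if "a \<le> k" for a
    using that by (induction a rule: inc_induct) (auto simp: upt_conv_Cons)
  from this[of 0] have "pcas v ?q v" using k by (simp add: g_def)
  moreover have "set ?q \<subseteq> parcs T" using g_R out by auto
  moreover have "distinct (map snd ?q)"
  proof -
    have gk: "g k = g 0" using k by (simp add: g_def)
    have "g (Suc a) \<noteq> g (Suc b)" if "a < b" "b < k" for a b
      using g_inj[of "Suc a" "Suc b"] g_inj[of 0 "Suc a"] gk that by (cases "Suc b = k") auto
    then show ?thesis by (auto simp: distinct_map comp_def inj_on_def) (metis nat_neq_iff)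
  qed
  ultimately have "pre_digraph.cycle (with_proj T) ?q"
    using v k by (auto simp: cycle_with_proj_iff)
  moreover have "3 \<le> length ?q" using \<open>3 \<le> k\<close> by simp
  ultimately show False using assms(1) unfolding undirected_tree_def by blast
qed

section \<open>Tangles exclude S-trees\<close>

lemma no_S_tree_if_abstract_tangle:
  assumes inv: "separation_system_in S" and nd: "\<forall>s\<in>S. \<not> degenerate s"
    and O': "abstract_tangle S O'" "extends S O' Q"
  shows "\<not> has_S_tree_over S (cosmall_triple_stars \<union> forced_singletons Q)"
proof
  assume "has_S_tree_over S (cosmall_triple_stars \<union> forced_singletons Q)"
  then obtain T :: "nat pair_pre_digraph" and \<alpha> where T: "S_tree S T \<alpha>"
    "\<And>t. t \<in> pverts T \<Longrightarrow> \<alpha> ` in_arcs (with_proj T) t \<in> cosmall_triple_stars \<union> forced_singletons Q"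
    by (auto simp: has_S_tree_over_def S_tree_over_def)
  have S: "\<alpha> e \<in> S" if "e \<in> parcs T" for e using T(1) that by (auto simp: S_tree_def)
  have rev: "\<alpha> (y, x) = (\<alpha> (x, y))\<^sup>\<star>" if "(x, y) \<in> parcs T" for x y
    using T(1) that by (auto simp: S_tree_def)
  have or: "s \<in> O' \<longleftrightarrow> s\<^sup>\<star> \<notin> O'" if "s \<in> S" for s
  proof -
    have "\<exists>!x. x \<in> {s, s\<^sup>\<star>} \<and> x \<in> O'"
      using O'(1) that by (auto simp: abstract_tangle_def orientation_of_def unoriented_def)
    moreover have "s \<noteq> s\<^sup>\<star>" using nd that by (simp add: degenerate_def)
    ultimately show ?thesis by blast
  qed
  interpret pair_graph T using T(1) by (simp add: S_tree_def undirected_tree_def)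
  have sym: "(y, x) \<in> parcs T" if "(x, y) \<in> parcs T" for x y
    using pair_sym_arcs that by (auto simp: symmetric_def dest: symD)
  \<comment> \<open>Each edge is oriented along the arc whose label the tangle contains, so at a
    sink all incoming labels lie in the tangle.\<close>
  obtain t where t: "t \<in> pverts T" "\<And>y. (t, y) \<in> parcs T \<Longrightarrow> \<alpha> (t, y) \<notin> O'"
    using undirected_tree_has_sink[of T "{e \<in> parcs T. \<alpha> e \<in> O'}"] T(1) rev or S
    unfolding S_tree_def by (smt (verit, best) mem_Collect_eq)
  have "\<alpha> ` in_arcs (with_proj T) t \<subseteq> O'"
  proof safe
    fix x y assume "(x, y) \<in> in_arcs (with_proj T) t"
    then have "(x, t) \<in> parcs T" "y = t" by (auto simp: in_arcs_def)
    then show "\<alpha> (x, y) \<in> O'" using t(2) sym rev or S by metis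
  qed
  moreover have "\<sigma> \<notin> cosmall_triple_stars \<union> forced_singletons Q" if "\<sigma> \<subseteq> O'" for \<sigma>
  proof
    assume "\<sigma> \<in> cosmall_triple_stars \<union> forced_singletons Q"
    then show False
    proof
      assume "\<sigma> \<in> cosmall_triple_stars"
      then show False using O'(1) that by (auto simp: abstract_tangle_def cosmall_triple_stars_def)
    next
      assume "\<sigma> \<in> forced_singletons Q"
      then obtain s where s: "\<sigma> = {s\<^sup>\<star>}" "s \<in> Q" by (auto simp: forced_singletons_def)
      \<comment> \<open>That \<open>s\<close> lies in \<open>S\<close>, where \<open>Q\<close> binds
        the tangle, follows from its inverse lying in \<open>O'\<close>.\<close>
      then have "s\<^sup>\<star> \<in> S"
        using that O'(1) by (auto simp: abstract_tangle_def orientation_of_def)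
      then have "s \<in> S" using inv invol_invol[of s] by (metis separation_system_in_def)
      then have "s \<in> O'" using O'(2) s by (auto simp: extends_def)
      then show False using or[OF \<open>s \<in> S\<close>] s that by simp
    qed
  qed
  ultimately show False using T(2)[OF t(1)] by blast
qed

theorem theorem3:
  fixes S Q :: "'u::distributive_universe set"
  assumes "separation_system_in S"
    and "submodular S"
    and "\<forall>s\<in>S. \<not> degenerate s"
    and "down_closed Q"
  shows "((\<exists>O'. abstract_tangle S O' \<and> extends S O' Q) \<or>
      has_S_tree_over S (cosmall_triple_stars \<union> forced_singletons Q)) \<and>
    \<not> ((\<exists>O'. abstract_tangle S O' \<and> extends S O' Q) \<and>
      has_S_tree_over S (cosmall_triple_stars \<union> forced_singletons Q))"
proof (intro conjI)
  show "(\<exists>O'. abstract_tangle S O' \<and> extends S O' Q) \<or>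
      has_S_tree_over S (cosmall_triple_stars \<union> forced_singletons Q)"
  proof (cases "contradictory S Q")
    case True
    then show ?thesis
      using branching_if_contradictory[OF assms(1,3)] S_tree_if_branching[OF _ _ assms(1)] by blast
  next
    case False
    then obtain X where "tangle_on S Q X"
      using tangle_if_not_contradictory[OF assms(1,2,4)] by blast
    then show ?thesis using abstract_tangle_if_tangle_on[OF assms(1,3)] by blast
  qed
  show "\<not> ((\<exists>O'. abstract_tangle S O' \<and> extends S O' Q) \<and>
      has_S_tree_over S (cosmall_triple_stars \<union> forced_singletons Q))"
    using no_S_tree_if_abstract_tangle[OF assms(1,3)] by blast
qed

end
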